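(* Let $n\ge 1$ and let $X\subseteq[0,1]^n$ be a nonempty closed set. Suppose the MV-algebra $\mathcal M(X)$ is not strongly semisimple. (i) Then there are a point $x\in X$ and a Bouligand-Severi tangent vector $u$ to $X$ at $x$ satisfying the following nonalignment condition: there is a sequence of distinct points $w_i\in X$, all distinct from $x$, such that $$\lim_{i\to\infty}w_i=x,\qquad \lim_{i\to\infty}\frac{w_i-x}{\|w_i-x\|}=u,\qquad w_i\notin\operatorname{conv}(x,x+u)\ \text{ for all } i.$$ (ii) In particular, if $n=2$, then there are a rational point $x\in X$ and a Bouligand-Severi tangent vector $u$ to $X$ at $x$ such that $u$ is outgoing and $u$ is a rational vector.
   Context: An MV-algebra is an algebra $(A,\oplus,\neg,0)$ such that $(A,\oplus,0)$ is a commutative monoid, $\neg\neg a=a$, $a\oplus\neg 0=\neg 0$, and $\neg(\neg a\oplus b)\oplus b=\neg(\neg b\oplus a)\oplus a$ for all $a,b\in A$. Its natural order is given by $a\le b$ iff $\neg a\oplus b=\neg 0$. An ideal of $A$ is a subset containing $0$, closed under $\oplus$, and downward closed for $\le$. An ideal $I$ is proper if $I\neq A$, and maximal if it is maximal among the proper ideals. The quotient $A/I$ is the quotient by the congruence $a\sim b$ iff $\neg(\neg a\oplus b)\oplus\neg(\neg b\oplus a)\in I$. The principal ideal generated by $g\in A$ is $\{a\in A\mid a\le g\oplus\cdots\oplus g \ (k \text{ summands}) \text{ for some } k\ge 0\}$ (the empty sum being $0$). $A$ is semisimple if the intersection of all its maximal ideals is $\{0\}$ (with the empty intersection equal to $A$,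 so that the trivial one-element algebra counts as semisimple). $A$ is strongly semisimple if for every principal ideal $I$ of $A$ the quotient $A/I$ is semisimple. A McNaughton function on $[0,1]^n$ is a continuous function $f\colon[0,1]^n\to[0,1]$ for which there are finitely many affine functions $p_1,\dots,p_k\colon\mathbb R^n\to\mathbb R$ with integer coefficients (including the constant term) such that for every $x\in[0,1]^n$ there is $i$ with $f(x)=p_i(x)$. $\mathcal M([0,1]^n)$ is the MV-algebra of all McNaughton functions on $[0,1]^n$ with the pointwise operations $\neg a=1-a$ and $a\oplus b=\min(1,a+b)$. For nonempty closed $X\subseteq[0,1]^n$, $\mathcal M(X)=\{f|_X\mid f\in\mathcal M([0,1]^n)\}$, with the same pointwise operations. Let $X\subseteq\mathbb R^n$ be closed, $x\in X$, and $u\in\mathbb R^n$ a unit vector (Euclidean norm $\|\cdot\|$). $u$ is a Bouligand-Severi tangent vector to $X$ at $x$ if there is a sequence $x_0,x_1,\dots$ of elements of $X$, all different from $x$, with $\lim_{i\to\infty}x_i=x$ and $\lim_{i\to\infty}(x_i-x)/\|x_i-x\|=u$. Such a $u$ is outgoing if for some $\lambda>0$ the segment $\operatorname{conv}(x,x+\lambda u)$ intersects $X$ only at $x$. A point of $\mathbb R^n$ is rational if all its coordinates are rational. A nonzero vector $w\in\mathbb R^n$ is rational if the line $\mathbb Rw$ contains at least two rational points. $\operatorname{conv}(a,b)$ denotes the closed segment joining $a$ and $b$. *)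

theory Defs
  imports "HOL-Analysis.Analysis" "HOL-Library.FuncSet"
begin

section \<open>MV-algebras\<close>

record 'a mv_struct =
  mv_carrier :: "'a set"
  mv_plus :: "'a \<Rightarrow> 'a \<Rightarrow> 'a"
  mv_neg :: "'a \<Rightarrow> 'a"
  mv_zero :: 'a

locale mv_algebra =
  fixes A :: "'a mv_struct"
  assumes zero_closed: "mv_zero A \<in> mv_carrier A"
    and neg_closed: "a \<in> mv_carrier A \<Longrightarrow> mv_neg A a \<in> mv_carrier A"
    and plus_closed: "\<lbrakk>a \<in> mv_carrier A; b \<in> mv_carrier A\<rbrakk> \<Longrightarrow> mv_plus A a b \<in> mv_carrier A"
    and plus_assoc: "\<lbrakk>a \<in> mv_carrier A; b \<in> mv_carrier A; c \<in> mv_carrier A\<rbrakk> \<Longrightarrow>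
      mv_plus A (mv_plus A a b) c = mv_plus A a (mv_plus A b c)"
    and plus_commute: "\<lbrakk>a \<in> mv_carrier A; b \<in> mv_carrier A\<rbrakk> \<Longrightarrow> mv_plus A a b = mv_plus A b a"
    and plus_zero: "a \<in> mv_carrier A \<Longrightarrow> mv_plus A a (mv_zero A) = a"
    and neg_neg: "a \<in> mv_carrier A \<Longrightarrow> mv_neg A (mv_neg A a) = a"
    and plus_neg_zero: "a \<in> mv_carrier A \<Longrightarrow>
      mv_plus A a (mv_neg A (mv_zero A)) = mv_neg A (mv_zero A)"
    and lukasiewicz: "\<lbrakk>a \<in> mv_carrier A; b \<in> mv_carrier A\<rbrakk> \<Longrightarrow>
      mv_plus A (mv_neg A (mv_plus A (mv_neg A a) b)) b =
      mv_plus A (mv_neg A (mv_plus A (mv_neg A b) a)) a"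

definition mv_le :: "'a mv_struct \<Rightarrow> 'a \<Rightarrow> 'a \<Rightarrow> bool" where
  "mv_le A a b \<longleftrightarrow> mv_plus A (mv_neg A a) b = mv_neg A (mv_zero A)"

definition mv_ideal :: "'a mv_struct \<Rightarrow> 'a set \<Rightarrow> bool" where
  "mv_ideal A I \<longleftrightarrow> I \<subseteq> mv_carrier A \<and> mv_zero A \<in> I \<and>
     (\<forall>a\<in>I. \<forall>b\<in>I. mv_plus A a b \<in> I) \<and>
     (\<forall>a\<in>mv_carrier A. \<forall>b\<in>I. mv_le A a b \<longrightarrow> a \<in> I)"

definition mv_proper_ideal :: "'a mv_struct \<Rightarrow> 'a set \<Rightarrow> bool" where
  "mv_proper_ideal A I \<longleftrightarrow> mv_ideal A I \<and> I \<noteq> mv_carrier A"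

definition mv_maximal_ideal :: "'a mv_struct \<Rightarrow> 'a set \<Rightarrow> bool" where
  "mv_maximal_ideal A I \<longleftrightarrow> mv_proper_ideal A I \<and>
     (\<forall>J. mv_proper_ideal A J \<and> I \<subseteq> J \<longrightarrow> J = I)"

definition mv_cong :: "'a mv_struct \<Rightarrow> 'a set \<Rightarrow> ('a \<times> 'a) set" where
  "mv_cong A I = {(a, b). a \<in> mv_carrier A \<and> b \<in> mv_carrier A \<and>
     mv_plus A (mv_neg A (mv_plus A (mv_neg A a) b)) (mv_neg A (mv_plus A (mv_neg A b) a)) \<in> I}"

definition mv_quotient :: "'a mv_struct \<Rightarrow> 'a set \<Rightarrow> 'a set mv_struct" where
  "mv_quotient A I =
     \<lparr> mv_carrier = mv_carrier A // mv_cong A I,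
       mv_plus = (\<lambda>C D. \<Union>a\<in>C. \<Union>b\<in>D. mv_cong A I `` {mv_plus A a b}),
       mv_neg = (\<lambda>C. \<Union>a\<in>C. mv_cong A I `` {mv_neg A a}),
       mv_zero = mv_cong A I `` {mv_zero A} \<rparr>"

definition mv_multiple :: "'a mv_struct \<Rightarrow> nat \<Rightarrow> 'a \<Rightarrow> 'a" where
  "mv_multiple A k g = ((mv_plus A g) ^^ k) (mv_zero A)"

definition mv_principal_ideal :: "'a mv_struct \<Rightarrow> 'a \<Rightarrow> 'a set" where
  "mv_principal_ideal A g = {a \<in> mv_carrier A. \<exists>k. mv_le A a (mv_multiple A k g)}"

text \<open>Intersecting with the carrier makes the empty intersection equal to the whole algebra, so
  that the trivial algebra is semisimple.\<close>

definition mv_semisimple :: "'a mv_struct \<Rightarrow> bool" where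
  "mv_semisimple A \<longleftrightarrow> mv_carrier A \<inter> \<Inter>{I. mv_maximal_ideal A I} = {mv_zero A}"

definition mv_strongly_semisimple :: "'a mv_struct \<Rightarrow> bool" where
  "mv_strongly_semisimple A \<longleftrightarrow>
     (\<forall>g\<in>mv_carrier A. mv_semisimple (mv_quotient A (mv_principal_ideal A g)))"


section \<open>McNaughton functions\<close>

definition unit_cube :: "(real ^ 'n) set" where
  "unit_cube = {x. \<forall>i. 0 \<le> x $ i \<and> x $ i \<le> 1}"

definition integer_affine :: "(real ^ 'n \<Rightarrow> real) \<Rightarrow> bool" where
  "integer_affine p \<longleftrightarrow>
     (\<exists>(a :: int ^ 'n) (b :: int). \<forall>x. p x = (\<Sum>i\<in>UNIV. of_int (a $ i) * x $ i) + of_int b)"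

text \<open>A function on a subset of \<open>\<real>\<^sup>n\<close> is represented by its extension taking the value
  \<open>undefined\<close> elsewhere, so that equality of functions is equality on the domain.\<close>

definition mcnaughton_functions :: "(real ^ 'n \<Rightarrow> real) set" where
  "mcnaughton_functions = {f \<in> unit_cube \<rightarrow>\<^sub>E {0..1}. continuous_on unit_cube f \<and>
     (\<exists>P. finite P \<and> (\<forall>p\<in>P. integer_affine p) \<and> (\<forall>x\<in>unit_cube. \<exists>p\<in>P. f x = p x))}"

definition mcnaughton_algebra :: "(real ^ 'n) set \<Rightarrow> (real ^ 'n \<Rightarrow> real) mv_struct" where
  "mcnaughton_algebra X =
     \<lparr> mv_carrier = (\<lambda>f. restrict f X) ` mcnaughton_functions,
       mv_plus = (\<lambda>f g. \<lambda>x\<in>X. min 1 (f x + g x)),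
       mv_neg = (\<lambda>f. \<lambda>x\<in>X. 1 - f x),
       mv_zero = (\<lambda>x\<in>X. 0) \<rparr>"

lemma integer_affine_const: "integer_affine (\<lambda>x. of_int c)"
  unfolding integer_affine_def by (intro exI[of _ 0] exI[of _ c]) simp

lemma integer_affine_add:
  assumes "integer_affine p" "integer_affine q"
  shows "integer_affine (\<lambda>x. p x + q x)"
proof -
  obtain a b where p: "\<And>x. p x = (\<Sum>i\<in>UNIV. of_int (a $ i) * x $ i) + of_int b"
    using assms(1) unfolding integer_affine_def by blast
  obtain c d where q: "\<And>x. q x = (\<Sum>i\<in>UNIV. of_int (c $ i) * x $ i) + of_int d"
    using assms(2) unfolding integer_affine_def by blast
  show ?thesis
    unfolding integer_affine_def
    by (intro exI[of _ "a + c"] exI[of _ "b + d"]) (simp add: p q sum.distrib distrib_right)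
qed

lemma integer_affine_minus:
  assumes "integer_affine p"
  shows "integer_affine (\<lambda>x. - p x)"
proof -
  obtain a b where p: "\<And>x. p x = (\<Sum>i\<in>UNIV. of_int (a $ i) * x $ i) + of_int b"
    using assms unfolding integer_affine_def by blast
  show ?thesis
    unfolding integer_affine_def
    by (intro exI[of _ "- a"] exI[of _ "- b"]) (simp add: p sum_negf)
qed

lemma mcnaughton_zero: "(\<lambda>x\<in>unit_cube :: (real ^ 'n) set. 0) \<in> mcnaughton_functions"
proof -
  have "\<exists>P. finite P \<and> (\<forall>p\<in>P. integer_affine p) \<and>
      (\<forall>x\<in>unit_cube. \<exists>p\<in>P. (\<lambda>x\<in>unit_cube. 0) x = p (x :: real ^ 'n))"
    using integer_affine_const[of 0] by (intro exI[of _ "{\<lambda>x. 0}"]) simp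
  moreover have "continuous_on unit_cube (\<lambda>x\<in>unit_cube :: (real ^ 'n) set. 0 :: real)"
    by (simp cong: continuous_on_cong_simp)
  moreover have "(\<lambda>x\<in>unit_cube :: (real ^ 'n) set. 0) \<in> unit_cube \<rightarrow>\<^sub>E {0..1 :: real}"
    by auto
  ultimately show ?thesis
    unfolding mcnaughton_functions_def by blast
qed

lemma mcnaughton_neg:
  fixes f :: "real ^ 'n \<Rightarrow> real"
  assumes "f \<in> mcnaughton_functions"
  shows "(\<lambda>x\<in>unit_cube. 1 - f x) \<in> mcnaughton_functions"
proof -
  obtain P where P: "finite P" "\<forall>p\<in>P. integer_affine p" "\<forall>x\<in>unit_cube. \<exists>p\<in>P. f x = p x"
    using assms unfolding mcnaughton_functions_def by blast
  have cont: "continuous_on unit_cube f" and rng: "\<And>x. x \<in> unit_cube \<Longrightarrow> f x \<in> {0..1}"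
    using assms unfolding mcnaughton_functions_def by auto
  let ?Q = "(\<lambda>p x. 1 + - p x) ` P"
  have "\<forall>q\<in>?Q. integer_affine q"
    using P(2) integer_affine_add[OF integer_affine_const[of 1] integer_affine_minus] by auto
  moreover have "\<forall>x\<in>unit_cube. \<exists>q\<in>?Q. (\<lambda>x\<in>unit_cube. 1 - f x) x = q x"
  proof
    fix x :: "real ^ 'n" assume x: "x \<in> unit_cube"
    then obtain p where "p \<in> P" "f x = p x" using P(3) by blast
    with x show "\<exists>q\<in>?Q. (\<lambda>x\<in>unit_cube. 1 - f x) x = q x" by auto
  qed
  moreover have "finite ?Q" using P(1) by simp
  moreover have "(\<lambda>x\<in>unit_cube. 1 - f x) \<in> unit_cube \<rightarrow>\<^sub>E {0..1}"
    using rng by auto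
  moreover have "continuous_on unit_cube (\<lambda>x\<in>unit_cube. 1 - f x)"
    using cont by (simp cong: continuous_on_cong_simp) (intro continuous_intros)
  ultimately show ?thesis
    unfolding mcnaughton_functions_def by blast
qed

lemma mcnaughton_plus:
  assumes "f \<in> mcnaughton_functions" "g \<in> mcnaughton_functions"
  shows "(\<lambda>x\<in>unit_cube. min 1 (f x + g x)) \<in> mcnaughton_functions"
proof -
  obtain P where P: "finite P" "\<forall>p\<in>P. integer_affine p" "\<forall>x\<in>unit_cube. \<exists>p\<in>P. f x = p x"
    using assms(1) unfolding mcnaughton_functions_def by blast
  obtain Q where Q: "finite Q" "\<forall>p\<in>Q. integer_affine p" "\<forall>x\<in>unit_cube. \<exists>p\<in>Q. g x = p x"
    using assms(2) unfolding mcnaughton_functions_def by blast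
  have cont: "continuous_on unit_cube f" "continuous_on unit_cube g"
    and rng: "\<And>x. x \<in> unit_cube \<Longrightarrow> f x \<in> {0..1}" "\<And>x. x \<in> unit_cube \<Longrightarrow> g x \<in> {0..1}"
    using assms unfolding mcnaughton_functions_def by auto
  let ?R = "insert (\<lambda>x. 1) ((\<lambda>(p, q) x. p x + q x) ` (P \<times> Q))"
  have "\<forall>r\<in>?R. integer_affine r"
    using P(2) Q(2) integer_affine_add integer_affine_const[of 1] by auto
  moreover have "\<exists>r\<in>?R. (\<lambda>x\<in>unit_cube. min 1 (f x + g x)) x = r x" if x: "x \<in> unit_cube" for x
  proof (cases "1 \<le> f x + g x")
    case True
    then show ?thesis using x by (intro bexI[of _ "\<lambda>x. 1"]) auto
  next
    case False
    obtain p q where "p \<in> P" "f x = p x" "q \<in> Q" "g x = q x"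
      using P(3) Q(3) x by blast
    with False x show ?thesis by (intro bexI[of _ "\<lambda>x. p x + q x"]) auto
  qed
  moreover have "continuous_on unit_cube (\<lambda>x\<in>unit_cube. min 1 (f x + g x))"
    using cont by (simp cong: continuous_on_cong_simp) (intro continuous_intros)
  moreover have "finite ?R" using P(1) Q(1) by simp
  moreover have "(\<lambda>x\<in>unit_cube. min 1 (f x + g x)) \<in> unit_cube \<rightarrow>\<^sub>E {0..1}"
    using rng by (auto simp: min_def)
  ultimately show ?thesis
    unfolding mcnaughton_functions_def by blast
qed

lemma mcnaughton_algebra_mv_algebra:
  fixes X :: "(real ^ 'n) set"
  assumes "X \<subseteq> unit_cube"
  shows "mv_algebra (mcnaughton_algebra X)"
proof -
  let ?M = "mcnaughton_functions :: (real ^ 'n \<Rightarrow> real) set"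
  let ?C = "(\<lambda>f. restrict f X) ` ?M"
  have ext: "\<And>a. a \<in> ?C \<Longrightarrow> a \<in> extensional X" by auto
  have rng: "0 \<le> a x \<and> a x \<le> 1" if a: "a \<in> ?C" and x: "x \<in> X" for a x
  proof -
    obtain f where "f \<in> ?M" "a = restrict f X" using a by blast
    then show ?thesis using x assms unfolding mcnaughton_functions_def by (auto dest!: PiE_mem)
  qed
  show ?thesis
  proof
    have "(\<lambda>x\<in>X. 0) = restrict (\<lambda>x\<in>unit_cube. 0) X"
      using assms by (auto simp: fun_eq_iff)
    then show "mv_zero (mcnaughton_algebra X) \<in> mv_carrier (mcnaughton_algebra X)"
      unfolding mcnaughton_algebra_def mv_struct.simps by (rule image_eqI[where f = "\<lambda>f. restrict f X"])
        (rule mcnaughton_zero)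
  next
    fix a assume "a \<in> mv_carrier (mcnaughton_algebra X)"
    then obtain f where f: "f \<in> ?M" "a = restrict f X"
      unfolding mcnaughton_algebra_def by auto
    have "(\<lambda>x\<in>X. 1 - a x) = restrict (\<lambda>x\<in>unit_cube. 1 - f x) X"
      using assms f by (auto simp: fun_eq_iff)
    then show "mv_neg (mcnaughton_algebra X) a \<in> mv_carrier (mcnaughton_algebra X)"
      unfolding mcnaughton_algebra_def mv_struct.simps by (rule image_eqI[where f = "\<lambda>f. restrict f X"])
        (rule mcnaughton_neg[OF f(1)])
  next
    fix a b assume "a \<in> mv_carrier (mcnaughton_algebra X)" "b \<in> mv_carrier (mcnaughton_algebra X)"
    then obtain f g where fg: "f \<in> ?M" "a = restrict f X" "g \<in> ?M" "b = restrict g X"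
      unfolding mcnaughton_algebra_def by auto
    have "(\<lambda>x\<in>X. min 1 (a x + b x)) = restrict (\<lambda>x\<in>unit_cube. min 1 (f x + g x)) X"
      using assms fg by (auto simp: fun_eq_iff)
    then show "mv_plus (mcnaughton_algebra X) a b \<in> mv_carrier (mcnaughton_algebra X)"
      unfolding mcnaughton_algebra_def mv_struct.simps by (rule image_eqI[where f = "\<lambda>f. restrict f X"])
        (rule mcnaughton_plus[OF fg(1) fg(3)])
  next
    fix a b c assume "a \<in> mv_carrier (mcnaughton_algebra X)" "b \<in> mv_carrier (mcnaughton_algebra X)"
      "c \<in> mv_carrier (mcnaughton_algebra X)"
    then have C: "a \<in> ?C" "b \<in> ?C" "c \<in> ?C" unfolding mcnaughton_algebra_def by simp_all
    have "min 1 (min 1 (a x + b x) + c x) = min 1 (a x + min 1 (b x + c x))" if "x \<in> X" for x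
      using rng[OF C(1) that] rng[OF C(2) that] rng[OF C(3) that] by linarith
    then show "mv_plus (mcnaughton_algebra X) (mv_plus (mcnaughton_algebra X) a b) c =
        mv_plus (mcnaughton_algebra X) a (mv_plus (mcnaughton_algebra X) b c)"
      unfolding mcnaughton_algebra_def by (simp add: fun_eq_iff)
  next
    fix a b
    show "mv_plus (mcnaughton_algebra X) a b = mv_plus (mcnaughton_algebra X) b a"
      unfolding mcnaughton_algebra_def by (simp add: add.commute)
  next
    fix a assume "a \<in> mv_carrier (mcnaughton_algebra X)"
    then have a: "a \<in> ?C" unfolding mcnaughton_algebra_def by simp
    show "mv_plus (mcnaughton_algebra X) a (mv_zero (mcnaughton_algebra X)) = a"
      "mv_neg (mcnaughton_algebra X) (mv_neg (mcnaughton_algebra X) a) = a"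
      using rng[OF a] ext[OF a] unfolding mcnaughton_algebra_def
      by (auto simp: fun_eq_iff extensional_def min_def intro: antisym)
    show "mv_plus (mcnaughton_algebra X) a (mv_neg (mcnaughton_algebra X) (mv_zero (mcnaughton_algebra X))) =
        mv_neg (mcnaughton_algebra X) (mv_zero (mcnaughton_algebra X))"
      using rng[OF a] unfolding mcnaughton_algebra_def
      by (auto simp: fun_eq_iff min_def)
  next
    fix a b assume "a \<in> mv_carrier (mcnaughton_algebra X)" "b \<in> mv_carrier (mcnaughton_algebra X)"
    then have C: "a \<in> ?C" "b \<in> ?C" unfolding mcnaughton_algebra_def by simp_all
    have "min 1 (1 - min 1 (1 - a x + b x) + b x) = min 1 (1 - min 1 (1 - b x + a x) + a x)"
      if "x \<in> X" for x
      using rng[OF C(1) that] rng[OF C(2) that] by linarith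
    then show "mv_plus (mcnaughton_algebra X) (mv_neg (mcnaughton_algebra X)
          (mv_plus (mcnaughton_algebra X) (mv_neg (mcnaughton_algebra X) a) b)) b =
        mv_plus (mcnaughton_algebra X) (mv_neg (mcnaughton_algebra X)
          (mv_plus (mcnaughton_algebra X) (mv_neg (mcnaughton_algebra X) b) a)) a"
      unfolding mcnaughton_algebra_def by (simp add: fun_eq_iff)
  qed
qed


section \<open>Tangents and rationality\<close>

definition bouligand_severi_tangent ::
  "(real ^ 'n) set \<Rightarrow> real ^ 'n \<Rightarrow> real ^ 'n \<Rightarrow> bool" where
  "bouligand_severi_tangent X x u \<longleftrightarrow> x \<in> X \<and> norm u = 1 \<and>
     (\<exists>s :: nat \<Rightarrow> real ^ 'n. (\<forall>i. s i \<in> X \<and> s i \<noteq> x) \<and> s \<longlonglongrightarrow> x \<and>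
        (\<lambda>i. (s i - x) /\<^sub>R norm (s i - x)) \<longlonglongrightarrow> u)"

definition outgoing :: "(real ^ 'n) set \<Rightarrow> real ^ 'n \<Rightarrow> real ^ 'n \<Rightarrow> bool" where
  "outgoing X x u \<longleftrightarrow> (\<exists>l>0. closed_segment x (x + l *\<^sub>R u) \<inter> X = {x})"

definition rational_point :: "real ^ 'n \<Rightarrow> bool" where
  "rational_point x \<longleftrightarrow> (\<forall>i. x $ i \<in> \<rat>)"

definition rational_vector :: "real ^ 'n \<Rightarrow> bool" where
  "rational_vector w \<longleftrightarrow> w \<noteq> 0 \<and>
     (\<exists>p\<in>span {w}. \<exists>q\<in>span {w}. p \<noteq> q \<and> rational_point p \<and> rational_point q)"

end

theory Submission
  imports Defs
begin

text \<open>Failure of strong semisimplicity yields \<open>f, g\<close> such that \<open>f\<close> vanishes on the zeros of \<open>g\<close> in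
  \<open>X\<close>, yet \<open>f\<close> exceeds every multiple of \<open>g\<close> somewhere on \<open>X\<close>: evaluation at such a zero gives a
  maximal ideal of the quotient by \<open>\<langle>g\<rangle>\<close>. By compactness there are points \<open>s\<^sub>i \<rightarrow> x\<close> of \<open>X\<close> with limit
  direction \<open>u\<close>, \<open>f s\<^sub>i > i g s\<^sub>i\<close>, and \<open>f, g\<close> each equal to a single affine piece along the
  sequence. Hence the piece of \<open>g\<close> is constantly zero on the ray from \<open>x\<close> along \<open>u\<close>, and no
  \<open>s\<^sub>i\<close> lies on that ray, for otherwise \<open>g s\<^sub>i = 0 < f s\<^sub>i\<close>. In the plane the two pieces have
  linearly independent integer linear parts, so \<open>x\<close> and \<open>u\<close> are rational; near \<open>x\<close> on the ray
  \<open>g\<close> is zero and \<open>f\<close> is not, so the ray leaves \<open>X\<close>.\<close>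

section \<open>Quotients of McNaughton algebras by principal ideals\<close>

lemma mcnaughton_algebra_simps:
  "mv_plus (mcnaughton_algebra X) = (\<lambda>f g. \<lambda>x\<in>X. min 1 (f x + g x))"
  "mv_neg (mcnaughton_algebra X) = (\<lambda>f. \<lambda>x\<in>X. 1 - f x)"
  "mv_zero (mcnaughton_algebra X) = (\<lambda>x\<in>X. 0)"
  "mv_carrier (mcnaughton_algebra X) = (\<lambda>f. restrict f X) ` mcnaughton_functions"
  by (simp_all add: mcnaughton_algebra_def)

lemma mcnaughton_carrier_range:
  assumes "X \<subseteq> unit_cube" "a \<in> mv_carrier (mcnaughton_algebra X)" "x \<in> X"
  shows "0 \<le> a x" "a x \<le> 1"
  using assms by (auto simp: mcnaughton_algebra_simps mcnaughton_functions_def dest!: PiE_mem)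

lemma mv_le_mcnaughton_iff:
  assumes "\<And>x. x \<in> X \<Longrightarrow> b x \<le> 1"
  shows "mv_le (mcnaughton_algebra X) a b \<longleftrightarrow> (\<forall>x\<in>X. a x \<le> b x)"
proof -
  have "min 1 (1 - a x + b x) = 1 \<longleftrightarrow> a x \<le> b x" for x by linarith
  then show ?thesis
    unfolding mv_le_def mcnaughton_algebra_simps by (auto simp: fun_eq_iff restrict_def)
qed

lemma mv_multiple_mcnaughton:
  assumes "X \<subseteq> unit_cube" "g \<in> mv_carrier (mcnaughton_algebra X)" "x \<in> X"
  shows "mv_multiple (mcnaughton_algebra X) k g x = min 1 (real k * g x)"
proof (induction k)
  case 0
  then show ?case using assms by (simp add: mv_multiple_def mcnaughton_algebra_simps)
next
  case (Suc k)
  then have "mv_multiple (mcnaughton_algebra X) (Suc k) g x = min 1 (g x + min 1 (real k * g x))"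
    using assms by (simp add: mv_multiple_def mcnaughton_algebra_simps)
  also have "\<dots> = min 1 (real (Suc k) * g x)"
    using mcnaughton_carrier_range[OF assms] by (auto simp: min_def algebra_simps)
  finally show ?case .
qed

text \<open>Members of the carrier are bounded by 1, so the truncation in \<open>mv_multiple\<close>
  drops out and the ideal is described by linear bounds \<open>k * g\<close> on
  \<open>X\<close>.\<close>

lemma mv_principal_ideal_mcnaughton_iff:
  assumes X: "X \<subseteq> unit_cube" and g: "g \<in> mv_carrier (mcnaughton_algebra X)"
  shows "a \<in> mv_principal_ideal (mcnaughton_algebra X) g \<longleftrightarrow>
    a \<in> mv_carrier (mcnaughton_algebra X) \<and> (\<exists>k::nat. \<forall>x\<in>X. a x \<le> real k * g x)"
proof -
  have "mv_le (mcnaughton_algebra X) a (mv_multiple (mcnaughton_algebra X) k g) \<longleftrightarrow>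
      (\<forall>x\<in>X. a x \<le> real k * g x)" if a: "a \<in> mv_carrier (mcnaughton_algebra X)" for k
    using mcnaughton_carrier_range[OF X a]
    by (subst mv_le_mcnaughton_iff) (auto simp: mv_multiple_mcnaughton[OF X g])
  then show ?thesis unfolding mv_principal_ideal_def by blast
qed

text \<open>At each point one of the two truncated differences is zero and the other is the distance
  of the values, so the congruence term evaluates to \<open>\<bar>a x - b x\<bar>\<close>.\<close>

lemma mv_cong_mcnaughton_iff:
  assumes X: "X \<subseteq> unit_cube" and g: "g \<in> mv_carrier (mcnaughton_algebra X)"
  shows "(a, b) \<in> mv_cong (mcnaughton_algebra X) (mv_principal_ideal (mcnaughton_algebra X) g) \<longleftrightarrow>
    a \<in> mv_carrier (mcnaughton_algebra X) \<and> b \<in> mv_carrier (mcnaughton_algebra X) \<and>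
    (\<exists>k::nat. \<forall>x\<in>X. \<bar>a x - b x\<bar> \<le> real k * g x)"
proof (cases "a \<in> mv_carrier (mcnaughton_algebra X) \<and> b \<in> mv_carrier (mcnaughton_algebra X)")
  case True
  interpret mv_algebra "mcnaughton_algebra X" by (rule mcnaughton_algebra_mv_algebra[OF X])
  let ?A = "mcnaughton_algebra X"
  let ?d = "mv_plus ?A (mv_neg ?A (mv_plus ?A (mv_neg ?A a) b)) (mv_neg ?A (mv_plus ?A (mv_neg ?A b) a))"
  have "?d \<in> mv_carrier ?A" using True by (intro plus_closed neg_closed) auto
  moreover have "?d x = \<bar>a x - b x\<bar>" if x: "x \<in> X" for x
    using x mcnaughton_carrier_range[OF X _ x, of a] mcnaughton_carrier_range[OF X _ x, of b] True
    by (auto simp: mcnaughton_algebra_simps(1-3) min_def)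
  ultimately show ?thesis
    using True unfolding mv_cong_def by (simp add: mv_principal_ideal_mcnaughton_iff[OF X g])
qed (auto simp: mv_cong_def)

lemma equiv_mv_cong_mcnaughton:
  assumes X: "X \<subseteq> unit_cube" and g: "g \<in> mv_carrier (mcnaughton_algebra X)"
  shows "equiv (mv_carrier (mcnaughton_algebra X))
    (mv_cong (mcnaughton_algebra X) (mv_principal_ideal (mcnaughton_algebra X) g))"
    (is "equiv ?C ?R")
proof (rule equivI)
  show "?R \<subseteq> ?C \<times> ?C" by (auto simp: mv_cong_def)
  show "refl_on ?C ?R"
    by (rule refl_onI) (auto simp: mv_cong_mcnaughton_iff[OF X g] intro: exI[of _ 0])
  show "sym ?R"
    by (rule symI) (auto simp: mv_cong_mcnaughton_iff[OF X g] abs_minus_commute)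
  show "trans ?R"
  proof (rule transI)
    fix a b c assume "(a, b) \<in> ?R" "(b, c) \<in> ?R"
    then obtain k l :: nat where *: "a \<in> ?C" "c \<in> ?C"
      "\<And>x. x \<in> X \<Longrightarrow> \<bar>a x - b x\<bar> \<le> real k * g x" "\<And>x. x \<in> X \<Longrightarrow> \<bar>b x - c x\<bar> \<le> real l * g x"
      unfolding mv_cong_mcnaughton_iff[OF X g] by blast
    have "\<bar>a x - c x\<bar> \<le> real (k + l) * g x" if "x \<in> X" for x
      using *(3,4)[OF that] by (simp add: distrib_right)
    then show "(a, c) \<in> ?R" using * unfolding mv_cong_mcnaughton_iff[OF X g] by blast
  qed
qed

text \<open>The quotient operations are unions over all representatives; they reduce to one
  representative because negation preserves \<open>\<bar>a x - b x\<bar>\<close> and truncated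
  addition is 1-Lipschitz in each argument, so the bounds \<open>k * g\<close> and
  \<open>l * g\<close> add up.\<close>

lemma mv_quotient_mcnaughton_ops:
  fixes X :: "(real ^ 'n) set" and g :: "real ^ 'n \<Rightarrow> real"
  defines "A \<equiv> mcnaughton_algebra X"
  defines "R \<equiv> mv_cong A (mv_principal_ideal A g)"
  defines "Q \<equiv> mv_quotient A (mv_principal_ideal A g)"
  assumes X: "X \<subseteq> unit_cube" and g: "g \<in> mv_carrier A"
    and a: "a \<in> mv_carrier A"
  shows "mv_neg Q (R `` {a}) = R `` {mv_neg A a}"
    and "b \<in> mv_carrier A \<Longrightarrow> mv_plus Q (R `` {a}) (R `` {b}) = R `` {mv_plus A a b}"
proof -
  interpret mv_algebra A unfolding A_def by (rule mcnaughton_algebra_mv_algebra[OF X])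
  have E: "equiv (mv_carrier A) R"
    using equiv_mv_cong_mcnaughton X g unfolding A_def R_def by blast
  note R_iff = mv_cong_mcnaughton_iff[OF X g[unfolded A_def], folded A_def, folded R_def]
  have "(\<lambda>a. R `` {mv_neg A a}) respects R"
  proof (rule congruentI)
    fix a b assume ab: "(a, b) \<in> R"
    then have "(mv_neg A a, mv_neg A b) \<in> R"
      unfolding R_iff by (auto intro!: neg_closed) (auto simp: A_def mcnaughton_algebra_simps abs_minus_commute)
    then show "R `` {mv_neg A a} = R `` {mv_neg A b}" by (rule equiv_class_eq[OF E])
  qed
  from UN_equiv_class[OF E this a] show "mv_neg Q (R `` {a}) = R `` {mv_neg A a}"
    unfolding Q_def mv_quotient_def R_def by simp
  have "(\<lambda>a b. R `` {mv_plus A a b}) respects2 R"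
  proof (rule congruent2I'; rule equiv_class_eq[OF E])
    fix a b c d assume "(a, b) \<in> R" "(c, d) \<in> R"
    then obtain k l :: nat where *: "a \<in> mv_carrier A" "b \<in> mv_carrier A"
      "c \<in> mv_carrier A" "d \<in> mv_carrier A"
      "\<And>x. x \<in> X \<Longrightarrow> \<bar>a x - b x\<bar> \<le> real k * g x" "\<And>x. x \<in> X \<Longrightarrow> \<bar>c x - d x\<bar> \<le> real l * g x"
      unfolding R_iff by blast
    have "\<bar>mv_plus A a c x - mv_plus A b d x\<bar> \<le> real (k + l) * g x" if "x \<in> X" for x
      using *(5,6)[OF that] that
      by (simp add: distrib_right A_def mcnaughton_algebra_simps)
    then show "(mv_plus A a c, mv_plus A b d) \<in> R"
      using * unfolding R_iff by (blast intro: plus_closed)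
  qed
  from UN_equiv_class2[OF E E this a]
  show "mv_plus Q (R `` {a}) (R `` {b}) = R `` {mv_plus A a b}" if "b \<in> mv_carrier A"
    using that unfolding Q_def mv_quotient_def R_def by simp
qed

section \<open>Evaluation at a zero of the generator\<close>

text \<open>Since \<open>g z = 0\<close>, evaluation at \<open>z\<close> is well defined on classes,
  and the given set is its kernel. It is maximal because a class with positive value at
  \<open>z\<close> has a multiple with value 1 there, which together with the kernel generates the
  unit.\<close>

lemma mv_maximal_ideal_point:
  fixes X :: "(real ^ 'n) set" and g :: "real ^ 'n \<Rightarrow> real"
  defines "A \<equiv> mcnaughton_algebra X"
  defines "R \<equiv> mv_cong A (mv_principal_ideal A g)"
  assumes X: "X \<subseteq> unit_cube" and g: "g \<in> mv_carrier A" and z: "z \<in> X" "g z = 0"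
  shows "mv_maximal_ideal (mv_quotient A (mv_principal_ideal A g))
    {R `` {a} | a. a \<in> mv_carrier A \<and> a z = 0}"
proof -
  interpret mv_algebra A unfolding A_def by (rule mcnaughton_algebra_mv_algebra[OF X])
  let ?Q = "mv_quotient A (mv_principal_ideal A g)"
  let ?M = "{R `` {a} | a. a \<in> mv_carrier A \<and> a z = 0}"
  let ?one = "mv_neg A (mv_zero A)"
  have E: "equiv (mv_carrier A) R"
    using equiv_mv_cong_mcnaughton X g unfolding A_def R_def by blast
  note R_iff = mv_cong_mcnaughton_iff[OF X g[unfolded A_def], folded A_def, folded R_def]
  note ops = mv_quotient_mcnaughton_ops[OF X g[unfolded A_def], folded A_def, folded R_def]
  have zeroQ: "mv_zero ?Q = R `` {mv_zero A}" and carQ: "mv_carrier ?Q = mv_carrier A // R"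
    by (simp_all add: mv_quotient_def R_def)
  \<comment> \<open>The congruence bound \<open>k * g z\<close> is zero, so all representatives of a
    class take the same value at \<open>z\<close>.\<close>
  have val: "a z = b z"
    if "R `` {a} = R `` {b}" "a \<in> mv_carrier A" "b \<in> mv_carrier A" for a b
  proof -
    have "(a, b) \<in> R" using that(1) eq_equiv_class_iff[OF E that(2,3)] by simp
    then obtain k :: nat where "\<bar>a z - b z\<bar> \<le> real k * g z" using z(1) unfolding R_iff by blast
    then show ?thesis using z(2) by simp
  qed
  have MI: "R `` {a} \<in> ?M" if "a \<in> mv_carrier A" "a z = 0" for a
    using that by blast
  have inM: "a z = 0" if a: "R `` {a} \<in> ?M" "a \<in> mv_carrier A" for a
  proof -
    obtain b where "b \<in> mv_carrier A" "b z = 0" "R `` {a} = R `` {b}" using a(1) by blast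
    then show ?thesis using val[of a b] a(2) by simp
  qed
  have one: "?one \<in> mv_carrier A" "?one z = 1"
    by (intro neg_closed zero_closed) (simp add: z(1) A_def mcnaughton_algebra_simps)
  have leQ: "mv_le ?Q (R `` {a}) (R `` {b}) \<longleftrightarrow> R `` {mv_plus A (mv_neg A a) b} = R `` {?one}"
    if "a \<in> mv_carrier A" "b \<in> mv_carrier A" for a b
    using that unfolding mv_le_def zeroQ by (simp add: ops neg_closed zero_closed)
  have ideal: "mv_ideal ?Q ?M"
    unfolding mv_ideal_def carQ zeroQ
  proof (intro conjI ballI impI)
    show "?M \<subseteq> mv_carrier A // R" by (auto intro: quotientI)
    show "R `` {mv_zero A} \<in> ?M"
      by (intro MI zero_closed) (simp add: z(1) A_def mcnaughton_algebra_simps)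
    show "mv_plus ?Q K L \<in> ?M" if KL: "K \<in> ?M" "L \<in> ?M" for K L
    proof -
      obtain a b where ab: "a \<in> mv_carrier A" "b \<in> mv_carrier A" "a z = 0" "b z = 0"
        "K = R `` {a}" "L = R `` {b}" using KL by blast
      have "mv_plus A a b z = 0" using ab z by (simp add: A_def mcnaughton_algebra_simps)
      then show ?thesis unfolding ab(5,6) ops(2)[OF ab(1,2)] using ab by (intro MI plus_closed)
    qed
    show "K \<in> ?M" if KL: "K \<in> mv_carrier A // R" "L \<in> ?M" "mv_le ?Q K L" for K L
    proof -
      obtain a where "a \<in> mv_carrier A" "K = R `` {a}" using KL(1) by (rule quotientE)
      moreover obtain b where "b \<in> mv_carrier A" "b z = 0" "L = R `` {b}" using KL(2) by blast
      ultimately have ab: "a \<in> mv_carrier A" "b \<in> mv_carrier A" "b z = 0"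
        "K = R `` {a}" "L = R `` {b}" by blast+
      have "R `` {mv_plus A (mv_neg A a) b} = R `` {?one}"
        using KL(3) unfolding ab(4,5) leQ[OF ab(1,2)] .
      from val[OF this plus_closed[OF neg_closed[OF ab(1)] ab(2)] one(1)]
      have "a z \<le> 0" using z(1) ab(3) one(2)
        by (simp add: A_def mcnaughton_algebra_simps min_def split: if_splits)
      moreover have "0 \<le> a z"
        using mcnaughton_carrier_range(1)[OF X _ z(1)] ab(1) unfolding A_def by blast
      ultimately show ?thesis unfolding ab(4) using ab(1) by (intro MI) auto
    qed
  qed
  have "R `` {?one} \<notin> ?M"
  proof
    assume "R `` {?one} \<in> ?M"
    from inM[OF this one(1)] one(2) show False by linarith
  qed
  moreover have "R `` {?one} \<in> mv_carrier ?Q" unfolding carQ using one(1) by (rule quotientI)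
  ultimately have "?M \<noteq> mv_carrier ?Q" by metis
  then have proper: "mv_proper_ideal ?Q ?M"
    using ideal unfolding mv_proper_ideal_def by simp
  have "J = ?M" if J: "mv_proper_ideal ?Q J" "?M \<subseteq> J" for J
  proof (rule ccontr)
    assume "J \<noteq> ?M"
    then obtain K where K: "K \<in> J" "K \<notin> ?M" using J(2) by blast
    have Jid: "mv_ideal ?Q J" and Jne: "J \<noteq> mv_carrier ?Q"
      using J(1) unfolding mv_proper_ideal_def by simp_all
    have Jcar: "J \<subseteq> mv_carrier A // R" and Jzero: "R `` {mv_zero A} \<in> J"
      and Jplus: "\<And>K L. K \<in> J \<Longrightarrow> L \<in> J \<Longrightarrow> mv_plus ?Q K L \<in> J"
      and Jdown: "\<And>K L. K \<in> mv_carrier A // R \<Longrightarrow> L \<in> J \<Longrightarrow> mv_le ?Q K L \<Longrightarrow> K \<in> J"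
      using Jid unfolding mv_ideal_def carQ zeroQ by (simp_all, blast)
    obtain h where h: "h \<in> mv_carrier A" "K = R `` {h}"
      using K(1) Jcar by (blast elim!: quotientE)
    have "h z \<noteq> 0" using K(2) MI[OF h(1)] unfolding h(2) by blast
    then have pos: "h z > 0"
      using mcnaughton_carrier_range(1)[OF X h(1)[unfolded A_def] z(1)] by simp
    have mult: "mv_multiple A k h \<in> mv_carrier A \<and> R `` {mv_multiple A k h} \<in> J" for k
    proof (induction k)
      case 0
      then show ?case using Jzero by (simp add: mv_multiple_def zero_closed)
    next
      case (Suc k)
      then have "mv_plus A h (mv_multiple A k h) \<in> mv_carrier A"
        "mv_plus ?Q K (R `` {mv_multiple A k h}) \<in> J"
        using h K(1) by (simp_all add: plus_closed Jplus)
      then show ?case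
        using ops(2)[OF h(1), of "mv_multiple A k h"] Suc h(2) by (simp add: mv_multiple_def)
    qed
    \<comment> \<open>With such a \<open>k\<close> the truncated multiple \<open>c\<close> is
      exactly 1 at \<open>z\<close>. The class of its negation then lies in \<open>?M\<close>, hence
      in \<open>J\<close>, and the two classes add up to the unit.\<close>
    obtain k :: nat where k: "1 < real k * h z" using reals_Archimedean3[OF pos] by blast
    define c where "c = mv_multiple A k h"
    have c: "c \<in> mv_carrier A" "R `` {c} \<in> J" using mult unfolding c_def by auto
    have cz: "c z = 1"
      using mv_multiple_mcnaughton[OF X _ z(1)] h(1) k unfolding c_def A_def by simp
    have "mv_neg A c z = 0" using cz z(1) by (simp add: A_def mcnaughton_algebra_simps)
    then have "R `` {mv_neg A c} \<in> ?M" using c(1) by (intro MI neg_closed)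
    then have "mv_plus ?Q (R `` {c}) (R `` {mv_neg A c}) \<in> J" using J(2) c(2) Jplus by blast
    moreover have "mv_plus A c (mv_neg A c) = ?one"
      by (simp add: A_def mcnaughton_algebra_simps fun_eq_iff)
    ultimately have one_J: "R `` {?one} \<in> J" using ops(2)[OF c(1) neg_closed[OF c(1)]] by simp
    have "L \<in> J" if L: "L \<in> mv_carrier A // R" for L
    proof -
      obtain a where a: "a \<in> mv_carrier A" "L = R `` {a}" using L by (rule quotientE)
      then have "mv_le ?Q L (R `` {?one})" using one by (simp add: leQ plus_neg_zero neg_closed)
      then show ?thesis using Jdown[OF L one_J] by blast
    qed
    then show False using Jne Jcar unfolding carQ by blast
  qed
  then show ?thesis using proper unfolding mv_maximal_ideal_def by blast
qed

text \<open>Here \<open>f\<close> represents a nonzero class lying in all maximal ideals of the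
  quotient. The ideals of evaluation at zeros of \<open>g\<close> force \<open>f\<close> to vanish
  there, and being nonzero in the quotient means that no multiple of \<open>g\<close> bounds
  \<open>f\<close>. From here on the argument is about real functions only.\<close>

lemma not_strongly_semisimple_mcnaughton:
  fixes X :: "(real ^ 'n) set"
  assumes X: "X \<subseteq> unit_cube" and "\<not> mv_strongly_semisimple (mcnaughton_algebra X)"
  obtains f g where "f \<in> mcnaughton_functions" "g \<in> mcnaughton_functions"
    "\<forall>z\<in>X. g z = 0 \<longrightarrow> f z = 0" "\<forall>k::nat. \<exists>y\<in>X. f y > real k * g y"
proof -
  let ?A = "mcnaughton_algebra X"
  interpret mv_algebra ?A by (rule mcnaughton_algebra_mv_algebra[OF X])
  obtain g where g: "g \<in> mv_carrier ?A"
    and ns: "\<not> mv_semisimple (mv_quotient ?A (mv_principal_ideal ?A g))"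
    using assms(2) unfolding mv_strongly_semisimple_def by blast
  let ?Q = "mv_quotient ?A (mv_principal_ideal ?A g)"
  let ?R = "mv_cong ?A (mv_principal_ideal ?A g)"
  have E: "equiv (mv_carrier ?A) ?R" using equiv_mv_cong_mcnaughton[OF X g] .
  have zeroQ: "mv_zero ?Q = ?R `` {mv_zero ?A}" and carQ: "mv_carrier ?Q = mv_carrier ?A // ?R"
    by (simp_all add: mv_quotient_def)
  \<comment> \<open>Zero always lies in the intersection, so failure of semisimplicity must supply a
    further element.\<close>
  have "mv_zero ?Q \<in> mv_carrier ?Q \<inter> \<Inter>{I. mv_maximal_ideal ?Q I}"
    unfolding carQ zeroQ using zero_closed
    by (auto intro: quotientI simp: mv_maximal_ideal_def mv_proper_ideal_def mv_ideal_def zeroQ)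
  then obtain K where K: "K \<in> mv_carrier ?Q" "\<And>I. mv_maximal_ideal ?Q I \<Longrightarrow> K \<in> I" "K \<noteq> mv_zero ?Q"
    using ns unfolding mv_semisimple_def by blast
  obtain f where f: "f \<in> mv_carrier ?A" "K = ?R `` {f}"
    using K(1) unfolding carQ by (rule quotientE)
  have vanish: "f z = 0" if z: "z \<in> X" "g z = 0" for z
  proof -
    have "K \<in> {?R `` {a} | a. a \<in> mv_carrier ?A \<and> a z = 0}"
      by (rule K(2)[OF mv_maximal_ideal_point[OF X g z]])
    then obtain a where a: "a \<in> mv_carrier ?A" "a z = 0" "?R `` {f} = ?R `` {a}" using f by blast
    then have "(f, a) \<in> ?R" using a(3) eq_equiv_class_iff[OF E f(1) a(1)] by simp
    then obtain k :: nat where "\<bar>f z - a z\<bar> \<le> real k * g z"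
      using z(1) unfolding mv_cong_mcnaughton_iff[OF X g] by blast
    then show ?thesis using z(2) a(2) by simp
  qed
  have big: "\<exists>y\<in>X. f y > real k * g y" for k :: nat
  proof (rule ccontr)
    assume "\<not> (\<exists>y\<in>X. f y > real k * g y)"
    then have "\<forall>x\<in>X. \<bar>f x - mv_zero ?A x\<bar> \<le> real k * g x"
      using mcnaughton_carrier_range[OF X f(1)] by (auto simp: mcnaughton_algebra_simps not_less)
    then have "(f, mv_zero ?A) \<in> ?R"
      using f zero_closed unfolding mv_cong_mcnaughton_iff[OF X g] by blast
    then show False using K(3) f(2) zeroQ equiv_class_eq[OF E] by blast
  qed
  \<comment> \<open>The carrier holds restrictions to \<open>X\<close>; lifts to the whole cube are
    taken because the later ray estimates leave \<open>X\<close>.\<close>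
  obtain f' g' where fg: "f' \<in> mcnaughton_functions" "g' \<in> mcnaughton_functions"
    "f = restrict f' X" "g = restrict g' X"
    using f(1) g by (auto simp: mcnaughton_algebra_simps)
  show ?thesis
  proof (rule that[OF fg(1,2)])
    show "\<forall>z\<in>X. g' z = 0 \<longrightarrow> f' z = 0" using vanish fg(3,4) by simp
    show "\<forall>k. \<exists>y\<in>X. f' y > real k * g' y"
    proof
      fix k
      obtain y where "y \<in> X" "f y > real k * g y" using big by blast
      then show "\<exists>y\<in>X. f' y > real k * g' y" using fg(3,4) by auto
    qed
  qed
qed

section \<open>Local behaviour of McNaughton functions\<close>

lemma unit_cube_eq_cbox: "unit_cube = cbox 0 (1 :: real ^ 'n)"
  by (auto simp: unit_cube_def mem_box_cart)

lemma unit_cube_ray: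
  fixes x u :: "real ^ 'n"
  assumes "x \<in> unit_cube" "x + T *\<^sub>R u \<in> unit_cube" "0 \<le> t" "t \<le> T"
  shows "x + t *\<^sub>R u \<in> unit_cube"
proof (cases "T = 0")
  case False
  have "convex (unit_cube :: (real ^ 'n) set)" unfolding unit_cube_eq_cbox by (rule convex_box)
  then have "(1 - t / T) *\<^sub>R x + (t / T) *\<^sub>R (x + T *\<^sub>R u) \<in> unit_cube"
    by (rule convexD_alt) (use assms False in simp_all)
  moreover have "(1 - t / T) *\<^sub>R x + (t / T) *\<^sub>R (x + T *\<^sub>R u) = x + t *\<^sub>R u"
    using False by (simp add: algebra_simps)
  ultimately show ?thesis by simp
qed (use assms in simp)

text \<open>A piece is encoded as a pair of gradient and constant term. Of integrality only
  rationality is kept, which is what Cramer's rule passes on to the point in the plane.\<close>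

lemma integer_affine_inner:
  fixes p :: "real ^ 'n \<Rightarrow> real"
  assumes "integer_affine p"
  shows "\<exists>cb :: (real ^ 'n) \<times> real. (\<forall>i. fst cb $ i \<in> \<rat>) \<and> snd cb \<in> \<rat> \<and>
    (\<forall>x. p x = fst cb \<bullet> x + snd cb)"
proof -
  obtain a :: "int ^ 'n" and b :: int where p: "\<And>x. p x = (\<Sum>i\<in>UNIV. of_int (a $ i) * x $ i) + of_int b"
    using assms unfolding integer_affine_def by blast
  show ?thesis
    by (rule exI[of _ "(\<chi> i. of_int (a $ i), of_int b)"]) (simp add: p inner_vec_def)
qed

lemma mcnaughton_pieces:
  fixes f :: "real ^ 'n \<Rightarrow> real"
  assumes "f \<in> mcnaughton_functions"
  obtains P :: "((real ^ 'n) \<times> real) set"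
  where "finite P" "\<forall>p\<in>P. (\<forall>i. fst p $ i \<in> \<rat>) \<and> snd p \<in> \<rat>"
    "\<forall>x\<in>unit_cube. \<exists>p\<in>P. f x = fst p \<bullet> x + snd p" "continuous_on unit_cube f"
proof -
  obtain P where P: "finite P" "\<forall>p\<in>P. integer_affine p" "\<forall>x\<in>unit_cube. \<exists>p\<in>P. f x = p x"
    and cont: "continuous_on unit_cube f"
    using assms unfolding mcnaughton_functions_def by blast
  obtain h where h: "\<forall>p\<in>P. (\<forall>i. fst (h p) $ i \<in> \<rat>) \<and> snd (h p) \<in> \<rat> \<and>
      (\<forall>x. p x = fst (h p) \<bullet> x + snd (h p))"
    using bchoice[of P "\<lambda>p cb. (\<forall>i. fst cb $ i \<in> \<rat>) \<and> snd cb \<in> \<rat> \<and>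
      (\<forall>x. p x = fst cb \<bullet> x + snd cb)"] P(2) integer_affine_inner by blast
  show ?thesis
  proof (rule that[of "h ` P"])
    show "\<forall>x\<in>unit_cube. \<exists>p\<in>h ` P. f x = fst p \<bullet> x + snd p"
    proof
      fix x :: "real ^ 'n" assume "x \<in> unit_cube"
      then obtain p where "p \<in> P" "f x = p x" using P(3) by blast
      then show "\<exists>p\<in>h ` P. f x = fst p \<bullet> x + snd p" using h by auto
    qed
  qed (use P(1) h cont in auto)
qed

text \<open>On the segment between two points of the cube, the sets where \<open>f\<close> follows
  one fixed affine piece are closed, finite in number and cover the segment, so the Lipschitz bounds
  of the pieces glue together.\<close>

lemma mcnaughton_lipschitz:
  fixes f :: "real ^ 'n \<Rightarrow> real"
  assumes "f \<in> mcnaughton_functions"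
  obtains L where "\<forall>x\<in>unit_cube. \<forall>y\<in>unit_cube. \<bar>f x - f y\<bar> \<le> L * norm (x - y)"
proof -
  obtain P where P: "finite P" and "\<forall>p\<in>P. (\<forall>i. fst p $ i \<in> \<rat>) \<and> snd p \<in> \<rat>"
    and pieces: "\<forall>x\<in>unit_cube. \<exists>p\<in>P. f x = fst p \<bullet> x + snd p"
    and cont: "continuous_on unit_cube f"
    by (rule mcnaughton_pieces[OF assms])
  \<comment> \<open>The sum dominates the norm of every gradient.\<close>
  define L where "L = (\<Sum>p\<in>P. norm (fst p))"
  have L: "norm (fst p) \<le> L" if "p \<in> P" for p
    unfolding L_def using P that by (intro member_le_sum) auto
  have L0: "L \<ge> 0" unfolding L_def by (intro sum_nonneg) auto
  have "\<bar>f x - f y\<bar> \<le> L * norm (x - y)" if xy: "x \<in> unit_cube" "y \<in> unit_cube" for x y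
  proof -
    let ?l = "\<lambda>t. x + t *\<^sub>R (y - x)"
    have l: "?l t \<in> unit_cube" if "t \<in> {0..1}" for t
      by (rule unit_cube_ray[where T = 1]) (use that xy in simp_all)
    have cl: "continuous_on {0..1} (\<lambda>t. f (?l t))"
      by (rule continuous_on_compose2[OF cont]) (auto intro!: continuous_intros l)
    let ?U = "\<lambda>p. {t \<in> {0..1}. f (?l t) - (fst p \<bullet> ?l t + snd p) = 0}"
    \<comment> \<open>The factor \<open>norm (x - y)\<close> is the speed of the parametrization
      \<open>?l\<close>; the claim is the case of the parameters 0 and 1.\<close>
    have "lipschitz_on (L * norm (x - y)) {0..1} (\<lambda>t. f (?l t))"
    proof (rule lipschitz_on_closed_Union[where U = ?U and I = P])
      show "lipschitz_on (L * norm (x - y)) (?U p) (\<lambda>t. f (?l t))" if p: "p \<in> P" for p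
      proof (rule lipschitz_onI)
        fix s t assume "s \<in> ?U p" "t \<in> ?U p"
        then have "f (?l s) = fst p \<bullet> ?l s + snd p" "f (?l t) = fst p \<bullet> ?l t + snd p"
          by simp_all
        then have "f (?l s) - f (?l t) = fst p \<bullet> (?l s - ?l t)"
          by (simp only: inner_diff_right add_diff_cancel_right)
        moreover have "?l s - ?l t = (s - t) *\<^sub>R (y - x)" by (simp add: algebra_simps)
        ultimately have "\<bar>f (?l s) - f (?l t)\<bar> = \<bar>fst p \<bullet> ((s - t) *\<^sub>R (y - x))\<bar>" by simp
        also have "\<bar>fst p \<bullet> ((s - t) *\<^sub>R (y - x))\<bar> \<le> norm (fst p) * norm ((s - t) *\<^sub>R (y - x))"
          by (rule Cauchy_Schwarz_ineq2)
        also have "\<dots> \<le> L * norm ((s - t) *\<^sub>R (y - x))"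
          by (intro mult_right_mono L p) auto
        finally show "dist (f (?l s)) (f (?l t)) \<le> L * norm (x - y) * dist s t"
          by (simp add: dist_real_def norm_minus_commute mult_ac)
      qed (use L0 in auto)
      show "closed (?U p)" if p: "p \<in> P" for p
        by (rule continuous_closed_preimage_constant)
          (auto intro!: continuous_intros cl)
      show "{0..1} \<subseteq> (\<Union>p\<in>P. ?U p)"
      proof
        fix t :: real assume t: "t \<in> {0..1}"
        obtain p where "p \<in> P" "f (?l t) = fst p \<bullet> ?l t + snd p" using bspec[OF pieces l[OF t]] by blast
        then show "t \<in> (\<Union>p\<in>P. ?U p)" using t by auto
      qed
    qed (use P L0 in auto)
    from lipschitz_onD[OF this, of 0 1] show ?thesis by (simp add: dist_real_def)
  qed
  then show ?thesis by (intro that[of L] ballI)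
qed

text \<open>Near \<open>t = 0\<close> only the finitely many affine pieces vanishing at \<open>x\<close> occur along the ray, so
  \<open>f (x + t u) / t\<close> is continuous with finite range on an interval \<open>(0, \<delta>)\<close>, hence constant.\<close>

lemma mcnaughton_ray:
  fixes f :: "real ^ 'n \<Rightarrow> real"
  assumes f: "f \<in> mcnaughton_functions" and x: "x \<in> unit_cube" and T: "T > 0"
    and xT: "x + T *\<^sub>R u \<in> unit_cube" and fx: "f x = 0"
  obtains d c where "0 < d" "d \<le> T" "\<forall>t\<in>{0<..<d}. f (x + t *\<^sub>R u) = c * t"
proof -
  obtain P where P: "finite P" and "\<forall>p\<in>P. (\<forall>i. fst p $ i \<in> \<rat>) \<and> snd p \<in> \<rat>"
    and pieces: "\<forall>x\<in>unit_cube. \<exists>p\<in>P. f x = fst p \<bullet> x + snd p"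
    and cont: "continuous_on unit_cube f"
    by (rule mcnaughton_pieces[OF f])
  let ?l = "\<lambda>t. x + t *\<^sub>R u"
  have l: "?l t \<in> unit_cube" if "t \<in> {0..T}" for t
    by (rule unit_cube_ray[OF x xT]) (use that in simp_all)
  have cl: "continuous_on {0..T} (\<lambda>t. f (?l t))"
    by (rule continuous_on_compose2[OF cont]) (auto intro!: continuous_intros l)
  have "((\<lambda>t. f (?l t)) \<longlongrightarrow> f (?l 0)) (at 0 within {0..T})"
    by (rule cl[unfolded continuous_on_def, rule_format]) (use T in simp)
  then have f0: "((\<lambda>t. f (?l t)) \<longlongrightarrow> 0) (at_right 0)"
    using T fx by (simp add: at_within_Icc_at_right)
  \<comment> \<open>If the piece \<open>p\<close> is nonzero at \<open>x\<close>, its difference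
    from \<open>f\<close> along the ray has a nonzero limit, so it cannot be active for small
    \<open>t\<close>.\<close>
  have "\<forall>\<^sub>F t in at_right 0. fst p \<bullet> x + snd p = 0 \<or> f (?l t) \<noteq> fst p \<bullet> ?l t + snd p" if p: "p \<in> P" for p
  proof (cases "fst p \<bullet> x + snd p = 0")
    case False
    have "((\<lambda>t. (fst p \<bullet> ?l t + snd p)) \<longlongrightarrow> (fst p \<bullet> ?l 0 + snd p)) (at_right 0)"
      by (intro tendsto_intros)
    from tendsto_diff[OF f0 this] have "((\<lambda>t. f (?l t) - (fst p \<bullet> ?l t + snd p)) \<longlongrightarrow> - (fst p \<bullet> x + snd p)) (at_right 0)" by simp
    then have "\<forall>\<^sub>F t in at_right 0. f (?l t) - (fst p \<bullet> ?l t + snd p) \<noteq> 0"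
      by (rule tendsto_imp_eventually_ne) (use False in simp)
    then show ?thesis by (rule eventually_mono) simp
  qed auto
  then have "\<forall>\<^sub>F t in at_right 0. \<forall>p\<in>P. fst p \<bullet> x + snd p = 0 \<or> f (?l t) \<noteq> fst p \<bullet> ?l t + snd p"
    by (intro eventually_ball_finite P) auto
  then obtain e where e: "e > 0" "\<And>t p. 0 < t \<Longrightarrow> t < e \<Longrightarrow> p \<in> P \<Longrightarrow> f (?l t) = fst p \<bullet> ?l t + snd p \<Longrightarrow> fst p \<bullet> x + snd p = 0"
    unfolding eventually_at_right_field by blast
  define d where "d = min e T"
  have d: "d > 0" "d \<le> e" "d \<le> T" using e T by (auto simp: d_def)
  have range: "f (?l t) / t \<in> (\<lambda>p. fst p \<bullet> u) ` P" if t: "t \<in> {0<..<d}" for t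
  proof -
    obtain p where p: "p \<in> P" "f (?l t) = fst p \<bullet> ?l t + snd p" using bspec[OF pieces l[of t]] t d by auto
    then have "fst p \<bullet> x + snd p = 0" using e(2) t d by auto
    then have "f (?l t) = t * (fst p \<bullet> u)"
      using p(2) by (simp add: inner_add_right algebra_simps)
    then show ?thesis using p(1) t by auto
  qed
  have "(\<lambda>t. f (?l t) / t) constant_on {0<..<d}"
  proof (rule continuous_finite_range_constant)
    show "continuous_on {0<..<d} (\<lambda>t. f (?l t) / t)"
      using d by (intro continuous_intros continuous_on_subset[OF cl]) auto
    show "finite ((\<lambda>t. f (?l t) / t) ` {0<..<d})"
      by (rule finite_subset[of _ "(\<lambda>p. fst p \<bullet> u) ` P"]) (use range P in auto)
  qed auto
  then obtain k where k: "\<And>t. t \<in> {0<..<d} \<Longrightarrow> f (?l t) / t = k" unfolding constant_on_def by blast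
  have "f (?l t) = k * t" if "0 < t" "t < d" for t
    using k[of t] that by (auto simp: field_simps)
  with d show ?thesis by (intro that[of d k]) auto
qed

text \<open>Replacing \<open>s i\<close> by the ray point at the same distance from \<open>x\<close>
  costs at most \<open>L\<close> times that distance times the deviation of the direction from
  \<open>u\<close>. The deviation tends to zero, so the slope along the sequence and the slope on
  the ray coincide.\<close>

lemma mcnaughton_ray_slope:
  fixes f :: "real ^ 'n \<Rightarrow> real"
  assumes f: "f \<in> mcnaughton_functions" and x: "x \<in> unit_cube" and T: "T > 0"
    and xT: "x + T *\<^sub>R u \<in> unit_cube" and fx: "f x = 0"
    and s: "\<And>i. s i \<in> unit_cube" "\<And>i. s i \<noteq> x" "s \<longlonglongrightarrow> x"
    and u: "(\<lambda>i. (s i - x) /\<^sub>R norm (s i - x)) \<longlonglongrightarrow> u"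
    and slope: "(\<lambda>i. f (s i) / norm (s i - x)) \<longlonglongrightarrow> c"
  obtains d where "0 < d" "\<forall>t\<in>{0<..<d}. f (x + t *\<^sub>R u) = c * t"
proof -
  obtain d k where d: "0 < d" "d \<le> T" "\<forall>t\<in>{0<..<d}. f (x + t *\<^sub>R u) = k * t"
    by (rule mcnaughton_ray[OF f x T xT fx])
  obtain L where L: "\<forall>x\<in>unit_cube. \<forall>y\<in>unit_cube. \<bar>f x - f y\<bar> \<le> L * norm (x - y)"
    by (rule mcnaughton_lipschitz[OF f])
  let ?t = "\<lambda>i. norm (s i - x)"
  have t0: "?t i > 0" for i using s(2) by simp
  have "?t \<longlonglongrightarrow> 0" using s(3) by (simp add: LIM_zero tendsto_norm_zero)
  then have ev: "\<forall>\<^sub>F i in sequentially. ?t i < d" using d(1) by (rule order_tendstoD)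
  have "(\<lambda>i. f (s i) / ?t i) \<longlonglongrightarrow> k"
  proof (rule Lim_transform)
    show "(\<lambda>i. k) \<longlonglongrightarrow> k" by simp
    have "(\<lambda>i. L * norm ((s i - x) /\<^sub>R norm (s i - x) - u)) \<longlonglongrightarrow> L * norm (u - u)"
      by (intro tendsto_intros u)
    then have lim: "(\<lambda>i. L * norm ((s i - x) /\<^sub>R norm (s i - x) - u)) \<longlonglongrightarrow> 0" by simp
    have "\<forall>\<^sub>F i in sequentially.
        norm (f (s i) / ?t i - k) \<le> L * norm ((s i - x) /\<^sub>R norm (s i - x) - u)"
      using ev
    proof eventually_elim
      case (elim i)
      \<comment> \<open>Because \<open>d \<le> T\<close>, the comparison point stays in the cube,
        where the Lipschitz bound is available.\<close>
      have "x + ?t i *\<^sub>R u \<in> unit_cube"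
        by (rule unit_cube_ray[OF x xT]) (use elim d(2) in simp_all)
      then have "\<bar>f (s i) - k * ?t i\<bar> \<le> L * norm (s i - (x + ?t i *\<^sub>R u))"
        using bspec[OF bspec[OF L s(1)[of i]], of "x + ?t i *\<^sub>R u"] bspec[OF d(3), of "?t i"] t0[of i] elim
        by simp
      also have "s i - (x + ?t i *\<^sub>R u) = ?t i *\<^sub>R ((s i - x) /\<^sub>R norm (s i - x) - u)"
        using t0[of i] by (simp add: algebra_simps)
      finally have "\<bar>f (s i) - k * ?t i\<bar> \<le> L * norm ((s i - x) /\<^sub>R norm (s i - x) - u) * ?t i"
        by (simp add: mult_ac)
      moreover have "\<bar>f (s i) - k * ?t i\<bar> = norm (f (s i) / ?t i - k) * ?t i"
      proof -
        have "f (s i) - k * ?t i = (f (s i) / ?t i - k) * ?t i"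
          using t0[of i] by (simp add: left_diff_distrib)
        then show ?thesis by (simp add: abs_mult)
      qed
      ultimately show ?case using t0[of i] by simp
    qed
    then show "(\<lambda>i. f (s i) / ?t i - k) \<longlonglongrightarrow> 0" by (rule Lim_null_comparison[OF _ lim])
  qed
  then have "k = c" using LIMSEQ_unique slope by blast
  with d show ?thesis by (intro that[of d]) auto
qed

section \<open>Extraction of a tangent direction by compactness\<close>

text \<open>Three successive subsequences are taken: one along which the points converge, one along
  which the directions converge on the unit sphere, and one along which \<open>f\<close> and
  \<open>g\<close> each follow a fixed affine piece. The vectors \<open>a\<close> and
  \<open>b\<close> are the gradients of these pieces.\<close>

lemma unbounded_quotient_tangent:
  fixes X :: "(real ^ 'n) set"
  assumes X: "closed X" "X \<subseteq> unit_cube"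
    and f: "f \<in> mcnaughton_functions" and g: "g \<in> mcnaughton_functions"
    and vanish: "\<And>z. z \<in> X \<Longrightarrow> g z = 0 \<Longrightarrow> f z = 0"
    and big: "\<And>k::nat. \<exists>y\<in>X. f y > real k * g y"
  obtains x u :: "real ^ 'n" and s :: "nat \<Rightarrow> real ^ 'n" and a b :: "real ^ 'n"
  where "x \<in> X" "norm u = 1" "f x = 0" "g x = 0"
    "\<forall>i. s i \<in> X \<and> s i \<noteq> x" "s \<longlonglongrightarrow> x"
    "(\<lambda>i. (s i - x) /\<^sub>R norm (s i - x)) \<longlonglongrightarrow> u"
    "\<forall>i. f (s i) = a \<bullet> (s i - x) \<and> g (s i) = b \<bullet> (s i - x)"
    "\<forall>i. f (s i) > real (Suc i) * g (s i)"
    "\<forall>i. a $ i \<in> \<rat> \<and> b $ i \<in> \<rat>" "a \<bullet> x \<in> \<rat>" "b \<bullet> x \<in> \<rat>"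
proof -
  obtain P where P: "finite P" and Prat: "\<forall>p\<in>P. (\<forall>i. fst p $ i \<in> \<rat>) \<and> snd p \<in> \<rat>"
    and Pf: "\<forall>x\<in>unit_cube. \<exists>p\<in>P. f x = fst p \<bullet> x + snd p"
    and contf: "continuous_on unit_cube f"
    by (rule mcnaughton_pieces[OF f])
  obtain Q where Q: "finite Q" and Qrat: "\<forall>p\<in>Q. (\<forall>i. fst p $ i \<in> \<rat>) \<and> snd p \<in> \<rat>"
    and Qg: "\<forall>x\<in>unit_cube. \<exists>p\<in>Q. g x = fst p \<bullet> x + snd p"
    and contg: "continuous_on unit_cube g"
    by (rule mcnaughton_pieces[OF g])
  have rng: "0 \<le> f z" "f z \<le> 1" "0 \<le> g z" if "z \<in> X" for z
    using that X(2) f g unfolding mcnaughton_functions_def by (auto dest!: PiE_mem)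
  have "compact X"
    using X compact_Int_closed[OF compact_cbox] unfolding unit_cube_eq_cbox by (metis inf.absorb2)
  \<comment> \<open>The shift to \<open>Suc k\<close> keeps the factor positive, so that
    \<open>f \<le> 1\<close> gives \<open>g (y k) \<le> inverse (real (Suc k))\<close> for every
    \<open>k\<close>.\<close>
  obtain y where y: "\<And>k. y k \<in> X" "\<And>k. f (y k) > real (Suc k) * g (y k)"
    using big[of "Suc _"] by metis
  obtain x r1 where x: "x \<in> X" and r1: "strict_mono r1" "(y \<circ> r1) \<longlonglongrightarrow> x"
    using \<open>compact X\<close> y(1) unfolding compact_def by metis
  have xc: "x \<in> unit_cube" using x X(2) by blast
  have lim_f: "(\<lambda>i. f (t i)) \<longlonglongrightarrow> f x" and lim_g: "(\<lambda>i. g (t i)) \<longlonglongrightarrow> g x"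
    if "t \<longlonglongrightarrow> x" "\<And>i. t i \<in> X" for t
    using continuous_on_tendsto_compose[OF contf that(1) xc]
      continuous_on_tendsto_compose[OF contg that(1) xc] that(2) X(2) by (simp_all add: subset_iff)
  have gy: "g (y k) \<le> inverse (real (Suc k))" for k
  proof -
    have "real (Suc k) * g (y k) \<le> 1" using y(2)[of k] rng(2)[OF y(1)[of k]] by linarith
    then show ?thesis by (simp add: field_simps)
  qed
  have "(\<lambda>i. g ((y \<circ> r1) i)) \<longlonglongrightarrow> 0"
  proof (rule tendsto_sandwich[OF _ _ tendsto_const])
    show "(\<lambda>i. inverse (real (Suc (r1 i)))) \<longlonglongrightarrow> 0"
      using LIMSEQ_subseq_LIMSEQ[OF LIMSEQ_inverse_real_of_nat r1(1)] by (simp add: o_def)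
  qed (use gy rng(3) y(1) in auto)
  then have gx: "g x = 0"
    using LIMSEQ_unique lim_g[OF r1(2)] y(1) by simp
  then have fx: "f x = 0" using vanish x by blast
  \<comment> \<open>Both functions vanish at \<open>x\<close>, whereas the inequality along
    \<open>y\<close> is strict.\<close>
  have yx: "y k \<noteq> x" for k
  proof
    assume "y k = x"
    then show False using y(2)[of k] fx gx by simp
  qed
  have "(y (r1 i) - x) /\<^sub>R norm (y (r1 i) - x) \<in> sphere 0 1" for i using yx by simp
  from compact_def[THEN iffD1, OF compact_sphere, rule_format,
      of "\<lambda>i. (y (r1 i) - x) /\<^sub>R norm (y (r1 i) - x)", OF this]
  obtain u r2 where u: "u \<in> sphere 0 1" and r2: "strict_mono r2"
    "((\<lambda>i. (y (r1 i) - x) /\<^sub>R norm (y (r1 i) - x)) \<circ> r2) \<longlonglongrightarrow> u"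
    by blast
  define y' where "y' = y \<circ> r1 \<circ> r2"
  have y'X: "y' i \<in> unit_cube" for i unfolding y'_def using y(1) X(2) by auto
  \<comment> \<open>Pigeonhole over pairs of pieces, so that one index set serves both
    functions.\<close>
  have "\<exists>pq\<in>P \<times> Q. infinite {i \<in> UNIV. f (y' i) = fst (fst pq) \<bullet> y' i + snd (fst pq) \<and>
      g (y' i) = fst (snd pq) \<bullet> y' i + snd (snd pq)}"
  proof (rule pigeonhole_infinite_rel)
    show "\<forall>i\<in>UNIV. \<exists>pq\<in>P \<times> Q. f (y' i) = fst (fst pq) \<bullet> y' i + snd (fst pq) \<and>
        g (y' i) = fst (snd pq) \<bullet> y' i + snd (snd pq)"
    proof
      fix i
      obtain p q where "p \<in> P" "f (y' i) = fst p \<bullet> y' i + snd p" "q \<in> Q" "g (y' i) = fst q \<bullet> y' i + snd q"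
        using bspec[OF Pf y'X[of i]] bspec[OF Qg y'X[of i]] by blast
      then show "\<exists>pq\<in>P \<times> Q. f (y' i) = fst (fst pq) \<bullet> y' i + snd (fst pq) \<and>
        g (y' i) = fst (snd pq) \<bullet> y' i + snd (snd pq)"
        by (intro bexI[of _ "(p, q)"]) auto
    qed
  qed (use P Q in auto)
  then obtain p q where pq: "p \<in> P" "q \<in> Q" and
    inf: "infinite {i. f (y' i) = fst p \<bullet> y' i + snd p \<and> g (y' i) = fst q \<bullet> y' i + snd q}" (is "infinite ?N")
    by auto
  define r3 where "r3 = enumerate ?N"
  have r3: "strict_mono r3" "\<And>i. r3 i \<in> ?N"
    unfolding r3_def using strict_mono_enumerate[OF inf] enumerate_in_set[OF inf] by auto
  define s where "s = y' \<circ> r3"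
  have s_eq: "s i = y (r1 (r2 (r3 i)))" for i by (simp add: s_def y'_def)
  have sX: "s i \<in> X" "s i \<noteq> x" for i unfolding s_eq using y(1) yx by auto
  have s_pq: "f (s i) = fst p \<bullet> s i + snd p" "g (s i) = fst q \<bullet> s i + snd q" for i
    using r3(2)[of i] unfolding s_def by simp_all
  have s_lim: "s \<longlonglongrightarrow> x"
    using LIMSEQ_subseq_LIMSEQ[OF LIMSEQ_subseq_LIMSEQ[OF r1(2) r2(1)] r3(1)]
    unfolding s_def y'_def .
  have s_dir: "(\<lambda>i. (s i - x) /\<^sub>R norm (s i - x)) \<longlonglongrightarrow> u"
    using LIMSEQ_subseq_LIMSEQ[OF r2(2) r3(1)] by (simp add: o_def s_eq)
  have "(\<lambda>i. fst p \<bullet> s i + snd p) \<longlonglongrightarrow> fst p \<bullet> x + snd p" "(\<lambda>i. fst q \<bullet> s i + snd q) \<longlonglongrightarrow> fst q \<bullet> x + snd q"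
    by (intro tendsto_intros s_lim)+
  \<comment> \<open>By continuity and uniqueness of limits the selected pieces also vanish at
    \<open>x\<close>; this cancels the constants and makes \<open>a \<bullet> x\<close> and
    \<open>b \<bullet> x\<close> rational.\<close>
  then have px: "fst p \<bullet> x + snd p = 0" and qx: "fst q \<bullet> x + snd q = 0"
    using lim_f[OF s_lim sX(1)] lim_g[OF s_lim sX(1)] fx gx LIMSEQ_unique unfolding s_pq by metis+
  \<comment> \<open>Passing to a subsequence only raises the original index, and
    \<open>g \<ge> 0\<close>, so the weaker factor \<open>Suc i\<close> is still valid.\<close>
  have s_big: "f (s i) > real (Suc i) * g (s i)" for i
  proof -
    have "i \<le> r1 (r2 (r3 i))" by (meson order_trans seq_suble r1(1) r2(1) r3(1))
    then have "real (Suc i) * g (s i) \<le> real (Suc (r1 (r2 (r3 i)))) * g (s i)"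
      by (intro mult_right_mono rng(3) sX(1)) simp
    also have "\<dots> < f (s i)" unfolding s_eq by (rule y(2))
    finally show ?thesis .
  qed
  show ?thesis
  proof (rule that[of x u s "fst p" "fst q"])
    show "\<forall>i. f (s i) = fst p \<bullet> (s i - x) \<and> g (s i) = fst q \<bullet> (s i - x)"
      using px qx by (simp add: s_pq inner_diff_right)
    have "fst p \<bullet> x = - snd p" "fst q \<bullet> x = - snd q" using px qx by linarith+
    then show "fst p \<bullet> x \<in> \<rat>" "fst q \<bullet> x \<in> \<rat>" using pq Prat Qrat by simp_all
    show "\<forall>i. fst p $ i \<in> \<rat> \<and> fst q $ i \<in> \<rat>" using pq Prat Qrat by simp
  qed (use x u fx gx sX s_lim s_dir s_big in simp_all)
qed

text \<open>A sequence converging to a point it never meets has infinite range; keeping one index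
  for each value gives the subsequence. This provides the distinctness of the points
  \<open>w i\<close>.\<close>

lemma ex_injective_subseq:
  fixes s :: "nat \<Rightarrow> 'a :: t1_space"
  assumes "\<And>i. s i \<noteq> x" "s \<longlonglongrightarrow> x"
  obtains r :: "nat \<Rightarrow> nat" where "strict_mono r" "inj (s \<circ> r)"
proof -
  have "infinite (range s)"
    using assms by (intro sequence_infinite_lemma[of s x]) auto
  moreover obtain U where U: "inj_on s U" "range s = s ` U"
    using subset_image_inj[of "range s" s UNIV] by blast
  ultimately have "infinite U" by auto
  then have e: "strict_mono (enumerate U)" "\<And>n. enumerate U n \<in> U"
    by (simp_all add: strict_mono_enumerate enumerate_in_set)
  have "inj (s \<circ> enumerate U)"
    by (intro comp_inj_on strict_mono_imp_inj_on e(1) inj_on_subset[OF U(1)]) (use e(2) in blast)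
  with e(1) show ?thesis by (rule that)
qed

section \<open>Rational vectors in the plane\<close>

lemma inner_plane:
  fixes x y :: "real ^ 'n"
  assumes "UNIV = {i, j :: 'n}" "i \<noteq> j"
  shows "x \<bullet> y = x $ i * y $ i + x $ j * y $ j"
  unfolding inner_vec_def assms(1) using assms(2) by simp

lemma plane_vec_eq_iff:
  fixes x y :: "real ^ 'n"
  assumes "UNIV = {i, j :: 'n}"
  shows "x = y \<longleftrightarrow> x $ i = y $ i \<and> x $ j = y $ j"
proof -
  have "k = i \<or> k = j" for k using assms by blast
  then show ?thesis unfolding vec_eq_iff by metis
qed

text \<open>In the plane the vectors orthogonal to \<open>b\<close> form a line, spanned by
  \<open>v\<close>, which is \<open>b\<close> turned by a right angle. The points 0 and
  \<open>v\<close> are the two rational points required on the line through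
  \<open>u\<close>.\<close>

lemma rational_vector_orthogonal:
  fixes b u :: "real ^ 'n"
  assumes ij: "UNIV = {i, j :: 'n}" "i \<noteq> j"
    and b: "\<forall>k. b $ k \<in> \<rat>" "b \<noteq> 0" and u: "u \<noteq> 0" "b \<bullet> u = 0"
  shows "rational_vector u"
proof -
  define v :: "real ^ 'n" where "v = (\<chi> k. if k = i then - b $ j else b $ i)"
  have v: "v $ i = - b $ j" "v $ j = b $ i" using ij(2) by (auto simp: v_def)
  have bu: "b $ i * u $ i = - (b $ j * u $ j)"
    using u(2) unfolding inner_plane[OF ij] by linarith
  have "v \<in> span {u}"
  proof (cases "u $ i = 0")
    case True
    then have uj: "u $ j \<noteq> 0" using u(1) by (simp add: plane_vec_eq_iff[OF ij(1)])
    then have "b $ j = 0" using bu True by simp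
    then have "v = (b $ i / u $ j) *\<^sub>R u"
      using True uj by (simp add: plane_vec_eq_iff[OF ij(1)] v)
    then show ?thesis by (simp add: span_base span_scale)
  next
    case False
    have "b $ i = - (b $ j * u $ j) / u $ i" using bu False by (simp add: field_simps)
    then have "v = (- b $ j / u $ i) *\<^sub>R u"
      using False by (simp add: plane_vec_eq_iff[OF ij(1)] v)
    then show ?thesis by (metis insertI1 span_base span_scale)
  qed
  moreover have "v \<noteq> 0" using b(2) by (auto simp: plane_vec_eq_iff[OF ij(1)] v)
  moreover have "rational_point v" unfolding rational_point_def using b(1) by (simp add: v_def)
  moreover have "0 \<in> span {u}" "rational_point (0 :: real ^ 'n)"
    by (simp_all add: span_zero rational_point_def)
  ultimately show ?thesis using u(1) unfolding rational_vector_def by metis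
qed

section \<open>Nonalignment in all dimensions and rationality in the plane\<close>

theorem theorem3p4:
  fixes X :: "(real ^ 'n) set"
  assumes "closed X" and "X \<noteq> {}" and "X \<subseteq> unit_cube"
    and "\<not> mv_strongly_semisimple (mcnaughton_algebra X)"
  shows "(\<exists>x u. x \<in> X \<and> bouligand_severi_tangent X x u \<and>
            (\<exists>w :: nat \<Rightarrow> real ^ 'n. inj w \<and> (\<forall>i. w i \<in> X \<and> w i \<noteq> x) \<and>
               w \<longlonglongrightarrow> x \<and> (\<lambda>i. (w i - x) /\<^sub>R norm (w i - x)) \<longlonglongrightarrow> u \<and>
               (\<forall>i. w i \<notin> closed_segment x (x + u))))
       \<and> (CARD('n) = 2 \<longrightarrow>
            (\<exists>x u. x \<in> X \<and> rational_point x \<and> bouligand_severi_tangent X x u \<and>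
               outgoing X x u \<and> rational_vector u))"
proof -
  obtain f g where f: "f \<in> mcnaughton_functions" and g: "g \<in> mcnaughton_functions"
    and vanish': "\<forall>z\<in>X. g z = 0 \<longrightarrow> f z = 0"
    and big': "\<forall>k::nat. \<exists>y\<in>X. f y > real k * g y"
    by (rule not_strongly_semisimple_mcnaughton[OF assms(3,4)])
  have vanish: "\<And>z. z \<in> X \<Longrightarrow> g z = 0 \<Longrightarrow> f z = 0"
    and big: "\<And>k::nat. \<exists>y\<in>X. f y > real k * g y"
    using vanish' big' by blast+
  obtain x u s a b where x: "x \<in> X" and u: "norm u = 1" and fx: "f x = 0" and gx: "g x = 0"
    and sX: "\<forall>i. s i \<in> X \<and> s i \<noteq> x" and lim: "s \<longlonglongrightarrow> x"
    and dir: "(\<lambda>i. (s i - x) /\<^sub>R norm (s i - x)) \<longlonglongrightarrow> u"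
    and fg: "\<forall>i. f (s i) = a \<bullet> (s i - x) \<and> g (s i) = b \<bullet> (s i - x)"
    and gt: "\<forall>i. f (s i) > real (Suc i) * g (s i)"
    and rat: "\<forall>i. a $ i \<in> \<rat> \<and> b $ i \<in> \<rat>" "a \<bullet> x \<in> \<rat>" "b \<bullet> x \<in> \<rat>"
    by (rule unbounded_quotient_tangent[OF assms(1,3) f g vanish big])
  have rng: "0 \<le> f z" "0 \<le> g z" if "z \<in> X" for z
    using that assms(3) f g unfolding mcnaughton_functions_def by (auto dest!: PiE_mem)
  \<comment> \<open>At a zero of \<open>g\<close> in \<open>X\<close> also \<open>f\<close> would
    vanish, against the strict inequality \<open>gt\<close>.\<close>
  have g_pos: "g (s i) > 0" for i
  proof (rule ccontr)
    assume "\<not> g (s i) > 0"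
    then have "g (s i) = 0" using rng(2) sX by (meson antisym_conv1 not_less)
    then show False using vanish[of "s i"] gt[rule_format, of i] sX by simp
  qed
  have slope_f: "(\<lambda>i. f (s i) / norm (s i - x)) \<longlonglongrightarrow> a \<bullet> u"
    and slope_g: "(\<lambda>i. g (s i) / norm (s i - x)) \<longlonglongrightarrow> b \<bullet> u"
    using tendsto_inner[OF tendsto_const dir, of a] tendsto_inner[OF tendsto_const dir, of b]
    by (simp_all add: fg divide_inverse mult.commute)
  \<comment> \<open>By \<open>gt\<close> the slopes of \<open>g\<close> lie between 0 and the slopes
    of \<open>f\<close> divided by \<open>Suc i\<close>; the latter converge to
    \<open>a \<bullet> u\<close>, so the quotients tend to zero.\<close>
  have bu: "b \<bullet> u = 0"
  proof (rule LIMSEQ_unique[OF slope_g])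
    have "(\<lambda>i. (f (s i) / norm (s i - x)) * inverse (real (Suc i))) \<longlonglongrightarrow> a \<bullet> u * 0"
      by (intro tendsto_mult slope_f LIMSEQ_inverse_real_of_nat)
    then have *: "(\<lambda>i. (f (s i) / norm (s i - x)) * inverse (real (Suc i))) \<longlonglongrightarrow> 0"
      by (simp only: mult_zero_right)
    show "(\<lambda>i. g (s i) / norm (s i - x)) \<longlonglongrightarrow> 0"
    proof (rule tendsto_sandwich[OF _ _ tendsto_const *])
      have "g (s i) / norm (s i - x) \<le> f (s i) / norm (s i - x) * inverse (real (Suc i))" for i
      proof -
        have "g (s i) \<le> f (s i) * inverse (real (Suc i))"
          using gt[rule_format, of i] by (simp add: field_simps)
        then have "g (s i) / norm (s i - x) \<le> f (s i) * inverse (real (Suc i)) / norm (s i - x)"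
          by (rule divide_right_mono) simp
        then show ?thesis by (simp add: mult_ac)
      qed
      then show "\<forall>\<^sub>F i in sequentially.
          g (s i) / norm (s i - x) \<le> f (s i) / norm (s i - x) * inverse (real (Suc i))"
        by simp
      show "\<forall>\<^sub>F i in sequentially. 0 \<le> g (s i) / norm (s i - x)"
        using g_pos by (simp add: less_imp_le)
    qed
  qed
  have tangent: "bouligand_severi_tangent X x u"
    unfolding bouligand_severi_tangent_def using x u sX lim dir by blast
  \<comment> \<open>On the line through \<open>x\<close> along \<open>u\<close> the piece of
    \<open>g\<close> is zero, while \<open>g\<close> is positive on the sequence. All real
    \<open>t\<close> are covered, in particular the segment up to \<open>x + u\<close>.\<close>
  have off_ray: "s i \<noteq> x + t *\<^sub>R u" for i t
    using g_pos[of i] fg[rule_format, of i] bu by auto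
  have "\<exists>w :: nat \<Rightarrow> real ^ 'n. inj w \<and> (\<forall>i. w i \<in> X \<and> w i \<noteq> x) \<and>
      w \<longlonglongrightarrow> x \<and> (\<lambda>i. (w i - x) /\<^sub>R norm (w i - x)) \<longlonglongrightarrow> u \<and>
      (\<forall>i. w i \<notin> closed_segment x (x + u))"
  proof -
    have "s i \<noteq> x" for i using sX by blast
    then obtain r :: "nat \<Rightarrow> nat" where r: "strict_mono r" "inj (s \<circ> r)"
      by (rule ex_injective_subseq[OF _ lim])
    have "(s \<circ> r) i \<notin> closed_segment x (x + u)" for i
      using off_ray[of "r i"] by (auto simp: closed_segment_def algebra_simps)
    then show ?thesis
      using r sX LIMSEQ_subseq_LIMSEQ[OF lim r(1)] LIMSEQ_subseq_LIMSEQ[OF dir r(1)]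
      by (intro exI[of _ "s \<circ> r"]) (simp add: o_def)
  qed
  moreover have "rational_point x \<and> outgoing X x u \<and> rational_vector u" if card: "CARD('n) = 2"
  proof (intro conjI)
    obtain i j :: 'n where ij: "UNIV = {i, j}" "i \<noteq> j" using card unfolding card_2_iff by blast
    have b0: "b \<noteq> 0" using g_pos[of 0] fg by auto
    have u0: "u \<noteq> 0" using u by auto
    show "rational_vector u"
      using rational_vector_orthogonal[OF ij _ b0 u0 bu] rat(1) by blast
    define D where "D = a $ i * b $ j - a $ j * b $ i"
    text \<open>If the linear parts \<open>a\<close> and \<open>b\<close> were proportional, the quotient \<open>f / g\<close> would be
      constant along \<open>s\<close>.\<close>
    have D: "D \<noteq> 0"
    proof
      assume D0: "D = 0"
      obtain k where k: "a = k *\<^sub>R b"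
      proof (cases "b $ i = 0")
        case True
        then have "b $ j \<noteq> 0" using b0 by (simp add: plane_vec_eq_iff[OF ij(1)])
        then have "a = (a $ j / b $ j) *\<^sub>R b"
          using D0 True by (simp add: plane_vec_eq_iff[OF ij(1)] D_def)
        then show ?thesis by (rule that)
      next
        case False
        then have "a = (a $ i / b $ i) *\<^sub>R b"
          using D0 by (simp add: plane_vec_eq_iff[OF ij(1)] D_def field_simps)
        then show ?thesis by (rule that)
      qed
      \<comment> \<open>For an index beyond the ratio \<open>k\<close>,
        \<open>f (s m) = k * g (s m)\<close> contradicts \<open>gt\<close>.\<close>
      obtain m where m: "k < real m" using reals_Archimedean2 by blast
      have "real (Suc m) * g (s m) < k * g (s m)"
        using gt[rule_format, of m] fg k by simp
      then have "real (Suc m) < k" using g_pos[of m] by simp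
      then show False using m by simp
    qed
    \<comment> \<open>Cramer's rule: \<open>x\<close> solves the linear system with rows
      \<open>a\<close> and \<open>b\<close>, determinant \<open>D\<close> and rational right-hand
      sides.\<close>
    have "x $ i = (b $ j * (a \<bullet> x) - a $ j * (b \<bullet> x)) / D"
      "x $ j = (a $ i * (b \<bullet> x) - b $ i * (a \<bullet> x)) / D"
      using D unfolding inner_plane[OF ij] by (simp_all add: D_def field_simps)
    moreover have "D \<in> \<rat>" unfolding D_def using rat(1) by simp
    ultimately have "x $ i \<in> \<rat>" "x $ j \<in> \<rat>" using rat by simp_all
    moreover have "k = i \<or> k = j" for k using ij(1) by blast
    ultimately show "rational_point x" unfolding rational_point_def by metis
    \<comment> \<open>The nonzero vector \<open>u\<close> cannot be orthogonal to two independent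
      vectors. So \<open>f\<close> has nonzero slope on the ray, while \<open>g\<close> has slope
      zero.\<close>
    have au: "a \<bullet> u \<noteq> 0"
    proof
      assume au: "a \<bullet> u = 0"
      have "D * u $ i = b $ j * (a \<bullet> u) - a $ j * (b \<bullet> u)"
        "D * u $ j = a $ i * (b \<bullet> u) - b $ i * (a \<bullet> u)"
        unfolding inner_plane[OF ij] D_def by (simp_all add: algebra_simps)
      then have "u = 0" using D au bu by (simp add: plane_vec_eq_iff[OF ij(1)])
      then show False using u0 by simp
    qed
    show "outgoing X x u"
    proof (rule ccontr)
      assume not_out: "\<not> outgoing X x u"
      have hit: "\<exists>t>0. t \<le> l \<and> x + t *\<^sub>R u \<in> X" if l: "l > 0" for l
      proof -
        have "closed_segment x (x + l *\<^sub>R u) \<inter> X \<noteq> {x}"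
          using not_out l unfolding outgoing_def by blast
        moreover have "x \<in> closed_segment x (x + l *\<^sub>R u) \<inter> X" using x by simp
        ultimately obtain z where z: "z \<in> closed_segment x (x + l *\<^sub>R u)" "z \<in> X" "z \<noteq> x" by blast
        then obtain r where r: "0 \<le> r" "r \<le> 1" "z = x + (r * l) *\<^sub>R u"
          by (auto simp: closed_segment_def algebra_simps)
        moreover have "r \<noteq> 0" using r z(3) by auto
        ultimately show ?thesis using l z(2)
          by (intro exI[of _ "r * l"]) (simp add: mult_le_cancel_right1)
      qed
      \<comment> \<open>A first hit at distance \<open>T\<close> puts an initial part of the ray
        into the cube by convexity, as the slope lemma demands.\<close>
      obtain T where T: "T > 0" "x + T *\<^sub>R u \<in> X" using hit[of 1] by auto
      have cube: "x \<in> unit_cube" "x + T *\<^sub>R u \<in> unit_cube" "\<And>i. s i \<in> unit_cube" "\<And>i. s i \<noteq> x"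
        using x T sX assms(3) by auto
      obtain d1 where d1: "0 < d1" "\<forall>t\<in>{0<..<d1}. f (x + t *\<^sub>R u) = (a \<bullet> u) * t"
        by (rule mcnaughton_ray_slope[OF f cube(1) T(1) cube(2) fx cube(3,4) lim dir slope_f])
      obtain d2 where d2: "0 < d2" "\<forall>t\<in>{0<..<d2}. g (x + t *\<^sub>R u) = (b \<bullet> u) * t"
        by (rule mcnaughton_ray_slope[OF g cube(1) T(1) cube(2) gx cube(3,4) lim dir slope_g])
      \<comment> \<open>A second hit, at most half of \<open>min d1 d2\<close> away, lies strictly
        inside both intervals; it is a point of \<open>X\<close> where \<open>g\<close> vanishes and
        \<open>f\<close> does not.\<close>
      obtain t where t: "t > 0" "t \<le> min d1 d2 / 2" "x + t *\<^sub>R u \<in> X"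
        using hit[of "min d1 d2 / 2"] d1(1) d2(1) by auto
      have "t \<in> {0<..<d1}" "t \<in> {0<..<d2}" using t d1(1) d2(1) by auto
      then have "g (x + t *\<^sub>R u) = 0" "f (x + t *\<^sub>R u) \<noteq> 0"
        using d1(2) d2(2) bu au t(1) by auto
      then show False using vanish[OF t(3)] by blast
    qed
  qed
  ultimately show ?thesis using x tangent by blast
qed

end
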